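(* For every integer $n\ge 1$, $$2\,Ch_n+n\,Ch_{n-1}=0.$$
   Context: The Changhee numbers of the first kind $Ch_n$, $n\ge 0$, are defined by the generating function (an identity of formal power series in $t$) $\sum_{n=0}^\infty Ch_n\frac{t^n}{n!}=\frac{2}{2+t}$. *)

theory Defs
  imports Complex_Main "HOL-Computational_Algebra.Formal_Power_Series"
begin

text \<open>
  Changhee numbers of the first kind, read off from their exponential generating
  function \<open>2 / (2 + t)\<close> in the ring of formal power series over the rationals.
  The division is a genuine one, since \<open>2 + t\<close> has a nonzero constant term.
\<close>

definition Ch :: "nat \<Rightarrow> rat" where
  "Ch n = fact n * fps_nth (2 / (2 + fps_X)) n"

lemma Ch_generating_function:
  "Abs_fps (\<lambda>n. Ch n / fact n) = 2 / (2 + fps_X)"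
  by (simp add: Ch_def fps_eq_iff)

end

theory Submission
  imports Defs
begin

text \<open>
  Write \<open>F = 2 / (2 + t)\<close>. Clearing the denominator gives \<open>(2 + t) F = 2\<close>, whose right-hand side
  has no coefficients in positive degree; hence \<open>2 F\<^sub>n + F\<^bsub>n-1\<^esub> = 0\<close> for \<open>n \<ge> 1\<close>. Passing from \<open>F\<^sub>n\<close> to
  \<open>Ch\<^sub>n = n! F\<^sub>n\<close> multiplies this by \<open>n! = n (n-1)!\<close>, which is where the factor \<open>n\<close> comes from.
\<close>

theorem mainTheorem9:
  fixes n :: nat
  assumes "n \<ge> 1"
  shows "2 * Ch n + of_nat n * Ch (n - 1) = 0"
proof -
  define F :: "rat fps" where "F = 2 / (2 + fps_X)"
  obtain m where n: "n = Suc m"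
    using assms by (cases n) auto
  \<comment> \<open>The constant term 2 makes the denominator a unit, so the division is exact.\<close>
  have "fps_nth (2 + fps_X :: rat fps) 0 \<noteq> 0"
    by simp
  then have "(2 + fps_X) * F = 2"
    unfolding F_def by (simp add: fps_divide_unit inverse_mult_eq_1' mult.left_commute)
  then have "fps_nth ((2 + fps_X) * F) (Suc m) = fps_nth 2 (Suc m)"
    by simp
  then have rec: "2 * fps_nth F (Suc m) + fps_nth F m = 0"
    by (simp add: distrib_right numeral_fps_const)
  have "2 * Ch n + of_nat n * Ch (n - 1) = fact n * (2 * fps_nth F (Suc m) + fps_nth F m)"
    by (simp add: Ch_def n F_def algebra_simps)
  then show ?thesis
    using rec by simp
qed

end
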